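(* Let $A,B$ be real symmetric $n\times n$ matrices. Assume that $A$ is a Robinson similarity matrix, that $B$ is a Robinson dissimilarity matrix, and moreover that $A$ or $B$ is a Toeplitz matrix. Then the identity permutation is an optimal solution to the problem $\mathrm{QAP}(A,B)$; that is, for every permutation $\pi$ of $[n]$, $$\sum_{i,j=1}^n A_{ij}B_{\pi(i)\pi(j)}\ \ge\ \sum_{i,j=1}^n A_{ij}B_{ij}.$$
   Context: $[n]=\{1,\ldots,n\}$. For real $n\times n$ matrices $A,B$, the quadratic assignment problem $\mathrm{QAP}(A,B)$ is $\min_{\pi}\sum_{i,j=1}^n A_{ij}B_{\pi(i)\pi(j)}$, the minimum being over all permutations $\pi$ of $[n]$. A real symmetric $n\times n$ matrix $A$ is a Robinson similarity matrix if $A_{ik}\le \min\{A_{ij},A_{jk}\}$ for all $1\le i\le j\le k\le n$. A real symmetric matrix $B$ is a Robinson dissimilarity matrix if $-B$ is a Robinson similarity matrix. A real $n\times n$ matrix $A$ is a Toeplitz matrix if $A_{ij}=A_{i+1,j+1}$ for all $1\le i,j\le n-1$. *)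

theory Defs
  imports "Jordan_Normal_Form.Matrix" "HOL-Combinatorics.Permutations"
begin

text \<open>
  An \<open>n\<close> by \<open>n\<close> matrix is an element of \<^term>\<open>carrier_mat n n\<close>, whose rows and columns are numbered
  from \<open>0\<close> to \<open>n - 1\<close>; permutations of the index set are taken on \<open>{0..<n}\<close> accordingly.
\<close>

definition symmetric_matrix :: "nat \<Rightarrow> real mat \<Rightarrow> bool" where
  "symmetric_matrix n A \<longleftrightarrow> A \<in> carrier_mat n n \<and> transpose_mat A = A"

definition robinson_similarity :: "nat \<Rightarrow> real mat \<Rightarrow> bool" where
  "robinson_similarity n A \<longleftrightarrow> symmetric_matrix n A \<and>
     (\<forall>i j k. i \<le> j \<and> j \<le> k \<and> k < n \<longrightarrow> A $$ (i, k) \<le> min (A $$ (i, j)) (A $$ (j, k)))"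

definition robinson_dissimilarity :: "nat \<Rightarrow> real mat \<Rightarrow> bool" where
  "robinson_dissimilarity n B \<longleftrightarrow> symmetric_matrix n B \<and> robinson_similarity n (- B)"

definition toeplitz :: "nat \<Rightarrow> real mat \<Rightarrow> bool" where
  "toeplitz n A \<longleftrightarrow> A \<in> carrier_mat n n \<and>
     (\<forall>i j. Suc i < n \<and> Suc j < n \<longrightarrow> A $$ (i, j) = A $$ (Suc i, Suc j))"

definition qap_cost :: "nat \<Rightarrow> real mat \<Rightarrow> real mat \<Rightarrow> (nat \<Rightarrow> nat) \<Rightarrow> real" where
  "qap_cost n A B \<pi> = (\<Sum>i = 0..<n. \<Sum>j = 0..<n. A $$ (i, j) * B $$ (\<pi> i, \<pi> j))"

definition qap_optimal :: "nat \<Rightarrow> real mat \<Rightarrow> real mat \<Rightarrow> (nat \<Rightarrow> nat) \<Rightarrow> bool" where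
  "qap_optimal n A B \<sigma> \<longleftrightarrow> is_arg_min (qap_cost n A B) (\<lambda>\<pi>. \<pi> permutes {0..<n}) \<sigma>"

end

theory Submission
  imports Defs
begin

text \<open>
  Put \<open>C = - B\<close>, so that \<open>A\<close> and \<open>C\<close> are Robinson similarities and the identity should maximise
  the sum of all \<open>A $$ (i, j) * C $$ (\<pi> i, \<pi> j)\<close>. Replacing \<open>\<pi>\<close> by its inverse exchanges the
  roles of \<open>A\<close> and \<open>C\<close>, so \<open>C\<close> may be taken to be the Toeplitz matrix. Its diagonal is constant,
  hence the diagonal terms do not depend on \<open>\<pi>\<close>, and by symmetry only the pairs \<open>i < j\<close> matter.

  A real function on a finite set is a constant plus a nonnegative combination of indicators of its
  superlevel sets, and the pairing of \<open>A\<close> with \<open>C\<close> is bilinear. So it suffices to count, for all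
  pairs of thresholds, the positions where both matrices are above their threshold
  (\<open>sum_mult_le_of_superlevel_counts\<close>). A superlevel set of \<open>A\<close>, restricted to \<open>i < j\<close>, is a graph
  \<open>G\<close> such that an edge \<open>i j\<close> forces all edges inside the interval from \<open>i\<close> to \<open>j\<close>; a superlevel set
  of \<open>C\<close> is a band \<open>\<bar>i - j\<bar> \<le> k\<close> (\<open>toeplitz_superlevel_band\<close>). The remaining combinatorial
  claim is that the natural order maximises the number of edges of \<open>G\<close> of length at most \<open>k\<close>.

  In the natural order, a vertex is the right end of \<open>min k (card (left_nbrs G S j))\<close> such edges. For
  an arbitrary order \<open>\<pi>\<close>, delete the vertex \<open>v\<close> that comes last in that order: it lies on at
  most \<open>min k (deg v)\<close> edges that \<open>\<pi>\<close> makes short. The sum of the quantities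
  \<open>min k (card (left_nbrs G S j))\<close> drops by at least this much when \<open>v\<close> is deleted, wherever \<open>v\<close> lies in
  the natural order (\<open>short_edges_delete\<close>), and induction on the number of vertices gives the claim
  (\<open>short_edges_le\<close>).
\<close>

section \<open>Reduction to superlevel sets\<close>

text \<open>
  Summation by parts, one value of \<open>f\<close> at a time. Where \<open>f\<close> equals its minimum \<open>b\<close>, the sum is
  \<open>b\<close> times the weight; the set where \<open>f\<close> exceeds \<open>b\<close> is smaller, its nonempty superlevel sets are
  superlevel sets of \<open>X\<close>, and by induction its sum is at least \<open>b\<close> times its weight. Passing from \<open>b\<close> down
  to \<open>m\<close> is harmless because the total weight is itself a superlevel sum.
\<close>

lemma superlevel_sum_lower_bound:
  fixes f w :: "'a \<Rightarrow> real"
  assumes "finite X" "\<And>t. 0 \<le> (\<Sum>x | x \<in> X \<and> t \<le> f x. w x)" "\<And>x. x \<in> X \<Longrightarrow> m \<le> f x"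
  shows "m * (\<Sum>x\<in>X. w x) \<le> (\<Sum>x\<in>X. f x * w x)"
  using assms
proof (induction "card X" arbitrary: X m rule: less_induct)
  case less
  show ?case
  proof (cases "X = {}")
    case True
    then show ?thesis by simp
  next
    case False
    define b where "b = Min (f ` X)"
    define Y where "Y = {x \<in> X. b < f x}"
    have bX: "b \<in> f ` X" and bmin: "\<And>x. x \<in> X \<Longrightarrow> b \<le> f x"
      unfolding b_def using less.prems(1) False by auto
    have mb: "m \<le> b" using bX less.prems(3) by auto
    have YX: "Y \<subset> X" using bX Y_def by auto
    have finY: "finite Y" using YX less.prems(1) finite_subset by blast
    have nonneg: "0 \<le> (\<Sum>x | x \<in> Y \<and> t \<le> f x. w x)" for t
    proof (cases "b < t")
      case True
      then have "{x. x \<in> Y \<and> t \<le> f x} = {x. x \<in> X \<and> t \<le> f x}"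
        unfolding Y_def by auto
      then show ?thesis using less.prems(2)[of t] by simp
    next
      case False
      show ?thesis
      proof (cases "Y = {}")
        case True
        then show ?thesis by simp
      next
        case ne: False
        \<comment> \<open>At a threshold up to \<open>b\<close>, all of \<open>Y\<close> qualifies, and \<open>Y\<close> is cut out of \<open>X\<close> by the
           threshold \<open>c\<close>.\<close>
        define c where "c = Min (f ` Y)"
        have "c \<in> f ` Y" and "\<And>x. x \<in> Y \<Longrightarrow> c \<le> f x"
          unfolding c_def using finY ne by auto
        then have "{x. x \<in> Y \<and> t \<le> f x} = {x. x \<in> X \<and> c \<le> f x}"
          using False unfolding Y_def by fastforce
        then show ?thesis using less.prems(2)[of c] by simp
      qed
    qed
    have "card Y < card X" using YX less.prems(1) psubset_card_mono by blast
    then have IH: "b * (\<Sum>x\<in>Y. w x) \<le> (\<Sum>x\<in>Y. f x * w x)"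
      using less.hyps[of Y b] finY nonneg bmin YX by auto
    have fb: "f x = b" if "x \<in> X - Y" for x
      using that bmin[of x] unfolding Y_def by auto
    have "(\<Sum>x\<in>X. f x * w x) = (\<Sum>x\<in>X - Y. f x * w x) + (\<Sum>x\<in>Y. f x * w x)"
      using YX less.prems(1) by (intro sum.subset_diff) auto
    also have "(\<Sum>x\<in>X - Y. f x * w x) = b * (\<Sum>x\<in>X - Y. w x)"
      using fb by (simp add: sum_distrib_left)
    finally have "b * (\<Sum>x\<in>X - Y. w x) + b * (\<Sum>x\<in>Y. w x) \<le> (\<Sum>x\<in>X. f x * w x)"
      using IH by simp
    moreover have "(\<Sum>x\<in>X. w x) = (\<Sum>x\<in>X - Y. w x) + (\<Sum>x\<in>Y. w x)"
      using YX less.prems(1) by (intro sum.subset_diff) auto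
    ultimately have "b * (\<Sum>x\<in>X. w x) \<le> (\<Sum>x\<in>X. f x * w x)"
      by (simp add: distrib_left)
    moreover have "0 \<le> (\<Sum>x\<in>X. w x)"
    proof -
      have "{x. x \<in> X \<and> b \<le> f x} = X" using bmin by auto
      then show ?thesis using less.prems(2)[of b] by simp
    qed
    ultimately show ?thesis using mb mult_right_mono order_trans by blast
  qed
qed

lemma superlevel_sum_nonneg:
  fixes f w :: "'a \<Rightarrow> real"
  assumes "finite X" "\<And>t. 0 \<le> (\<Sum>x | x \<in> X \<and> t \<le> f x. w x)" "(\<Sum>x\<in>X. w x) = 0"
  shows "0 \<le> (\<Sum>x\<in>X. f x * w x)"
proof -
  have "(if X = {} then 0 else Min (f ` X)) * (\<Sum>x\<in>X. w x) \<le> (\<Sum>x\<in>X. f x * w x)"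
    using assms(1,2) by (intro superlevel_sum_lower_bound) auto
  then show ?thesis using assms(3) by simp
qed

text \<open>
  Here the values of \<open>f\<close> carry weight \<open>1\<close> and those of \<open>g\<close> weight \<open>- 1\<close>, on two disjoint copies
  of \<open>X\<close>.
\<close>

lemma sum_le_of_superlevel_counts:
  fixes f g :: "'a \<Rightarrow> real"
  assumes fin: "finite X"
    and counts: "\<And>t. card {x \<in> X. t \<le> g x} \<le> card {x \<in> X. t \<le> f x}"
  shows "(\<Sum>x\<in>X. g x) \<le> (\<Sum>x\<in>X. f x)"
proof -
  define h where "h = case_sum f g"
  define w :: "'a + 'a \<Rightarrow> real" where "w = case_sum (\<lambda>_. 1) (\<lambda>_. - 1)"
  have "0 \<le> (\<Sum>z\<in>X <+> X. h z * w z)"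
  proof (rule superlevel_sum_nonneg)
    fix t
    have split: "{z. z \<in> X <+> X \<and> t \<le> h z} = {x \<in> X. t \<le> f x} <+> {x \<in> X. t \<le> g x}"
      unfolding h_def by auto
    show "0 \<le> (\<Sum>z | z \<in> X <+> X \<and> t \<le> h z. w z)"
      unfolding split using fin counts[of t] by (simp add: sum.Plus w_def)
  qed (use fin in \<open>auto simp: sum.Plus w_def\<close>)
  then show ?thesis
    using fin by (simp add: sum.Plus h_def w_def sum_negf)
qed

text \<open>
  The superlevel sets of \<open>a\<close> reduce the claim to the case where \<open>a\<close> is an indicator function, and on
  each of them the superlevel sets of \<open>c\<close> and \<open>c'\<close> are then compared by counting.
\<close>

lemma sum_mult_le_of_superlevel_counts:
  fixes a c c' :: "'a \<Rightarrow> real"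
  assumes fin: "finite X"
    and total: "(\<Sum>x\<in>X. c' x) = (\<Sum>x\<in>X. c x)"
    and counts: "\<And>s t. card {x \<in> X. s \<le> a x \<and> t \<le> c' x} \<le> card {x \<in> X. s \<le> a x \<and> t \<le> c x}"
  shows "(\<Sum>x\<in>X. a x * c' x) \<le> (\<Sum>x\<in>X. a x * c x)"
proof -
  have "0 \<le> (\<Sum>x\<in>X. a x * (c x - c' x))"
  proof (rule superlevel_sum_nonneg[OF fin])
    fix s
    have "(\<Sum>x | x \<in> X \<and> s \<le> a x. c' x) \<le> (\<Sum>x | x \<in> X \<and> s \<le> a x. c x)"
      using fin counts[of s] by (intro sum_le_of_superlevel_counts) (auto simp: conj_assoc)
    then show "0 \<le> (\<Sum>x | x \<in> X \<and> s \<le> a x. c x - c' x)"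
      by (simp add: sum_subtractf)
  qed (use total in \<open>simp add: sum_subtractf\<close>)
  then show ?thesis by (simp add: right_diff_distrib sum_subtractf)
qed

section \<open>Short edges in a linear layout of an interval-closed graph\<close>

text \<open>
  A predicate \<open>G\<close> stands for the graph on the natural numbers whose edges are the pairs \<open>i < j\<close>
  with \<open>G i j\<close>.
\<close>

definition interval_closed :: "(nat \<Rightarrow> nat \<Rightarrow> bool) \<Rightarrow> bool" where
  "interval_closed G \<longleftrightarrow> (\<forall>i i' j' j. i \<le> i' \<and> i' < j' \<and> j' \<le> j \<and> G i j \<longrightarrow> G i' j')"

definition left_nbrs :: "(nat \<Rightarrow> nat \<Rightarrow> bool) \<Rightarrow> nat set \<Rightarrow> nat \<Rightarrow> nat set" where
  "left_nbrs G S j = {i \<in> S. i < j \<and> G i j}"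

definition right_nbrs :: "(nat \<Rightarrow> nat \<Rightarrow> bool) \<Rightarrow> nat set \<Rightarrow> nat \<Rightarrow> nat set" where
  "right_nbrs G S i = {j \<in> S. i < j \<and> G i j}"

lemma finite_nbrs [simp]:
  "finite S \<Longrightarrow> finite (left_nbrs G S j)" "finite S \<Longrightarrow> finite (right_nbrs G S i)"
  by (simp_all add: left_nbrs_def right_nbrs_def)

lemma interval_closedD:
  "interval_closed G \<Longrightarrow> G i j \<Longrightarrow> i \<le> i' \<Longrightarrow> i' < j' \<Longrightarrow> j' \<le> j \<Longrightarrow> G i' j'"
  unfolding interval_closed_def by blast

lemma card_rank_less:
  fixes R :: "'a::linorder set"
  assumes "finite R"
  shows "card {j \<in> R. card {x \<in> R. x < j} < m} = min m (card R)"
  using assms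
proof (induction R rule: finite_linorder_max_induct)
  case empty
  then show ?case by simp
next
  case (insert b R)
  have below: "{x \<in> insert b R. x < j} = {x \<in> R. x < j}" if "j \<in> R" for j
    using insert.hyps(2) that by (auto dest: order.strict_trans)
  have below_b: "{x \<in> insert b R. x < b} = R"
    using insert.hyps(2) by auto
  have "{j \<in> insert b R. card {x \<in> insert b R. x < j} < m} =
      {j \<in> R. card {x \<in> R. x < j} < m} \<union> (if card R < m then {b} else {})"
    using below below_b by auto
  moreover have "b \<notin> R" using insert.hyps(2) by auto
  ultimately show ?case
    using insert by auto
qed

text \<open>
  Let \<open>d\<close> be the number of left neighbours of \<open>v\<close>. Deleting \<open>v\<close> loses the term \<open>min k d\<close> and one unit
  for every right neighbour \<open>j\<close> of \<open>v\<close> that has at most \<open>k\<close> left neighbours. By interval closure the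
  left neighbours of \<open>j\<close> other than \<open>v\<close> are left neighbours of \<open>v\<close> or right neighbours of \<open>v\<close> below
  \<open>j\<close>, so each of the first \<open>k - d\<close> right neighbours of \<open>v\<close> qualifies.
\<close>

lemma short_edges_delete:
  assumes G: "interval_closed G" and fin: "finite S" and v: "v \<in> S"
  shows "(\<Sum>j\<in>S - {v}. min k (card (left_nbrs G (S - {v}) j)))
      + min k (card (left_nbrs G S v) + card (right_nbrs G S v))
    \<le> (\<Sum>j\<in>S. min k (card (left_nbrs G S j)))"
proof -
  define L where "L = left_nbrs G S v"
  define R where "R = right_nbrs G S v"
  define D where "D = {j \<in> R. card (left_nbrs G S j) \<le> k}"
  have finL: "finite L" and finR: "finite R"
    using fin by (auto simp: L_def R_def)
  have RS: "R \<subseteq> S - {v}" by (auto simp: R_def right_nbrs_def)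
  have rank: "card (left_nbrs G S j) \<le> Suc (card L + card {x \<in> R. x < j})" if "j \<in> R" for j
  proof -
    have j: "v < j" "G v j" using that by (auto simp: R_def right_nbrs_def)
    have "left_nbrs G S j \<subseteq> insert v (L \<union> {x \<in> R. x < j})"
    proof
      fix x assume x: "x \<in> left_nbrs G S j"
      consider "x < v" | "x = v" | "v < x" by linarith
      then show "x \<in> insert v (L \<union> {x \<in> R. x < j})"
      proof cases
        case 1
        then have "G x v" using x j interval_closedD[OF G, of x j x v]
          by (auto simp: left_nbrs_def)
        then show ?thesis using 1 x by (auto simp: L_def left_nbrs_def)
      next
        case 3
        then have "G v x" using x j interval_closedD[OF G, of v j v x]
          by (auto simp: left_nbrs_def)
        then show ?thesis using 3 x by (auto simp: R_def left_nbrs_def right_nbrs_def)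
      qed simp
    qed
    then have "card (left_nbrs G S j) \<le> card (insert v (L \<union> {x \<in> R. x < j}))"
      using finL finR by (intro card_mono) auto
    also have "\<dots> \<le> Suc (card (L \<union> {x \<in> R. x < j}))"
      by (simp add: card_insert_le_m1)
    also have "\<dots> \<le> Suc (card L + card {x \<in> R. x < j})"
      by (simp add: card_Un_le)
    finally show ?thesis .
  qed
  have "{j \<in> R. card {x \<in> R. x < j} < k - card L} \<subseteq> D"
    using rank by (fastforce simp: D_def)
  then have "min (k - card L) (card R) \<le> card D"
    using card_rank_less[OF finR, of "k - card L"] card_mono[of D] finR
    by (metis (no_types, lifting) D_def finite_Collect_conjI finite_subset mem_Collect_eq subsetI)
  then have gain: "min k (card L + card R) \<le> min k (card L) + card D"
    by linarith
  have drop: "min k (card (left_nbrs G (S - {v}) j)) + (if j \<in> D then 1 else 0)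
      \<le> min k (card (left_nbrs G S j))" for j
  proof (cases "j \<in> D")
    case True
    then have "left_nbrs G S j = insert v (left_nbrs G (S - {v}) j)"
      using v by (auto simp: D_def R_def left_nbrs_def right_nbrs_def)
    moreover have "v \<notin> left_nbrs G (S - {v}) j" by (simp add: left_nbrs_def)
    ultimately have "card (left_nbrs G S j) = Suc (card (left_nbrs G (S - {v}) j))"
      using fin by simp
    then show ?thesis using True by (simp add: D_def)
  next
    case False
    have "card (left_nbrs G (S - {v}) j) \<le> card (left_nbrs G S j)"
      using fin by (intro card_mono) (auto simp: left_nbrs_def)
    then show ?thesis using False by auto
  qed
  have "(\<Sum>j\<in>S - {v}. if j \<in> D then 1 else 0) = card D"
  proof -
    have "(S - {v}) \<inter> D = D" using RS by (auto simp: D_def)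
    then show ?thesis using fin by (simp add: sum.If_cases Int_def[symmetric])
  qed
  moreover have "(\<Sum>j\<in>S - {v}. min k (card (left_nbrs G (S - {v}) j)) + (if j \<in> D then 1 else 0))
      \<le> (\<Sum>j\<in>S - {v}. min k (card (left_nbrs G S j)))"
    by (intro sum_mono drop)
  ultimately have "(\<Sum>j\<in>S - {v}. min k (card (left_nbrs G (S - {v}) j))) + card D
      \<le> (\<Sum>j\<in>S - {v}. min k (card (left_nbrs G S j)))"
    by (simp add: sum.distrib)
  moreover have "(\<Sum>j\<in>S. min k (card (left_nbrs G S j)))
      = min k (card L) + (\<Sum>j\<in>S - {v}. min k (card (left_nbrs G S j)))"
    using fin v by (simp add: sum.remove L_def)
  ultimately show ?thesis using gain by (simp add: L_def R_def)
qed

text \<open>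
  The map \<open>p\<close> lays the vertices out on a line, and the left side counts the edges whose length in
  this layout is at most \<open>k\<close>. Deleting the vertex that is laid out last destroys at most
  \<open>min k (deg v)\<close> of them, since only \<open>k\<close> places before it are within reach; the right side drops by
  at least as much. The right side is defined through the order of \<open>S\<close> but mentions no distances,
  which makes it meaningful for the vertex sets with gaps that arise in the induction.
\<close>

lemma short_edges_le:
  fixes p :: "nat \<Rightarrow> nat"
  assumes G: "interval_closed G" and "finite S" and "inj_on p S"
  shows "card {(i, j). i \<in> S \<and> j \<in> S \<and> i < j \<and> G i j \<and> p i \<le> p j + k \<and> p j \<le> p i + k}
    \<le> (\<Sum>j\<in>S. min k (card (left_nbrs G S j)))"
  using assms(2,3)
proof (induction "card S" arbitrary: S rule: less_induct)
  case less
  define E where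
    "E T = {(i, j). i \<in> T \<and> j \<in> T \<and> i < j \<and> G i j \<and> p i \<le> p j + k \<and> p j \<le> p i + k}" for T
  have finE: "finite (E T)" if "finite T" for T
    by (rule finite_subset[of _ "T \<times> T"]) (use that in \<open>auto simp: E_def\<close>)
  show ?case
  proof (cases "S = {}")
    case True
    then show ?thesis by simp
  next
    case False
    have fin: "finite S" by (fact less.prems(1))
    have "Max (p ` S) \<in> p ` S" using fin False by simp
    then obtain v where v: "v \<in> S" and pv: "p v = Max (p ` S)" by auto
    have pmax: "p x \<le> p v" if "x \<in> S" for x using that fin pv by simp
    define U where "U = {x \<in> left_nbrs G S v \<union> right_nbrs G S v. p v \<le> p x + k}"
    have finU: "finite U" using fin by (simp add: U_def)
    have "card U \<le> k"
    proof -
      \<comment> \<open>As \<open>v\<close> comes last under \<open>p\<close>, the vertices close to it occupy the \<open>k\<close> places before it.\<close>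
      have US: "U \<subseteq> S - {v}"
        by (auto simp: U_def left_nbrs_def right_nbrs_def)
      have "p x < p v" if "x \<in> U" for x
        using that US pmax[of x] inj_onD[OF less.prems(2), of x v] v
        by (metis Diff_iff insertI1 le_neq_implies_less subsetD)
      then have "p ` U \<subseteq> {p v - k..<p v}" by (auto simp: U_def)
      then have "card (p ` U) \<le> card {p v - k..<p v}" by (intro card_mono) auto
      moreover have "card (p ` U) = card U"
        using US by (intro card_image inj_on_subset[OF less.prems(2)]) auto
      ultimately show ?thesis by simp
    qed
    moreover have "card U \<le> card (left_nbrs G S v) + card (right_nbrs G S v)"
    proof -
      have "card U \<le> card (left_nbrs G S v \<union> right_nbrs G S v)"
        using fin by (intro card_mono) (auto simp: U_def)
      then show ?thesis using card_Un_le le_trans by blast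
    qed
    ultimately have cU: "card U \<le> min k (card (left_nbrs G S v) + card (right_nbrs G S v))"
      by simp
    have "E S \<subseteq> E (S - {v}) \<union> (\<lambda>x. (min x v, max x v)) ` U"
    proof
      fix e assume "e \<in> E S"
      then obtain i j where e: "e = (i, j)" "i \<in> S" "j \<in> S" "i < j" "G i j"
        "p i \<le> p j + k" "p j \<le> p i + k" by (auto simp: E_def)
      consider "i = v" | "j = v" | "i \<noteq> v" "j \<noteq> v" by blast
      then show "e \<in> E (S - {v}) \<union> (\<lambda>x. (min x v, max x v)) ` U"
      proof cases
        case 1
        then have "j \<in> U" "e = (min j v, max j v)"
          using e by (auto simp: U_def right_nbrs_def)
        then show ?thesis by blast
      next
        case 2
        then have "i \<in> U" "e = (min i v, max i v)"
          using e by (auto simp: U_def left_nbrs_def)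
        then show ?thesis by blast
      qed (use e in \<open>auto simp: E_def\<close>)
    qed
    then have "card (E S) \<le> card (E (S - {v}) \<union> (\<lambda>x. (min x v, max x v)) ` U)"
      using finU fin finE by (intro card_mono) auto
    also have "\<dots> \<le> card (E (S - {v})) + card ((\<lambda>x. (min x v, max x v)) ` U)"
      by (rule card_Un_le)
    also have "\<dots> \<le> card (E (S - {v})) + card U"
      using card_image_le[OF finU] by simp
    also have "\<dots> \<le> (\<Sum>j\<in>S - {v}. min k (card (left_nbrs G (S - {v}) j)))
        + min k (card (left_nbrs G S v) + card (right_nbrs G S v))"
    proof -
      have "card (S - {v}) < card S" using fin v by (rule card_Diff1_less)
      moreover have "inj_on p (S - {v})" using less.prems(2) by (simp add: inj_on_diff)
      ultimately have "card (E (S - {v})) \<le> (\<Sum>j\<in>S - {v}. min k (card (left_nbrs G (S - {v}) j)))"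
        unfolding E_def using less.hyps[of "S - {v}"] fin by blast
      then show ?thesis using cU by (rule add_mono)
    qed
    also have "\<dots> \<le> (\<Sum>j\<in>S. min k (card (left_nbrs G S j)))"
      by (rule short_edges_delete[OF G fin v])
    finally show ?thesis by (simp add: E_def)
  qed
qed

text \<open>
  When the vertices are \<open>0, \<dots>, n - 1\<close>, the left neighbours of \<open>j\<close> are consecutive and end at
  \<open>j - 1\<close>, so the \<open>k\<close> nearest of them are within distance \<open>k\<close>.
\<close>

lemma sum_left_nbrs_le_short_edges:
  assumes G: "interval_closed G"
  shows "(\<Sum>j<n. min k (card (left_nbrs G {..<n} j)))
    \<le> card {(i, j). i < j \<and> j < n \<and> G i j \<and> j \<le> i + k}"
proof -
  have "min k (card (left_nbrs G {..<n} j)) \<le> card {i. i < j \<and> G i j \<and> j \<le> i + k}"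
    if "j < n" for j
  proof (cases "\<exists>i<j. G i j \<and> i + k < j")
    case True
    then obtain i where i: "i < j" "G i j" "i + k < j" by blast
    have "{j - k..<j} \<subseteq> {i. i < j \<and> G i j \<and> j \<le> i + k}"
      using i interval_closedD[OF G i(2), of _ j] by auto
    then have "card {j - k..<j} \<le> card {i. i < j \<and> G i j \<and> j \<le> i + k}"
      by (intro card_mono) auto
    then show ?thesis using i by simp
  next
    case False
    then have "left_nbrs G {..<n} j \<subseteq> {i. i < j \<and> G i j \<and> j \<le> i + k}"
      by (auto simp: left_nbrs_def not_less)
    then have "card (left_nbrs G {..<n} j) \<le> card {i. i < j \<and> G i j \<and> j \<le> i + k}"
      by (intro card_mono) auto
    then show ?thesis by simp
  qed
  then have "(\<Sum>j<n. min k (card (left_nbrs G {..<n} j)))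
      \<le> (\<Sum>j<n. card {i. i < j \<and> G i j \<and> j \<le> i + k})"
    by (intro sum_mono) auto
  also have "\<dots> = card (SIGMA j:{..<n}. {i. i < j \<and> G i j \<and> j \<le> i + k})"
    by (simp add: card_SigmaI)
  also have "\<dots> = card (prod.swap ` (SIGMA j:{..<n}. {i. i < j \<and> G i j \<and> j \<le> i + k}))"
    by (simp add: card_image)
  also have "prod.swap ` (SIGMA j:{..<n}. {i. i < j \<and> G i j \<and> j \<le> i + k})
      = {(i, j). i < j \<and> j < n \<and> G i j \<and> j \<le> i + k}"
    by (auto simp: image_iff)
  finally show ?thesis .
qed

lemma identity_maximises_short_edges:
  fixes p :: "nat \<Rightarrow> nat"
  assumes G: "interval_closed G" and p: "inj_on p {..<n}"
  shows "card {(i, j). i < j \<and> j < n \<and> G i j \<and> p i \<le> p j + k \<and> p j \<le> p i + k}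
    \<le> card {(i, j). i < j \<and> j < n \<and> G i j \<and> j \<le> i + k}"
proof -
  have "{(i, j). i < j \<and> j < n \<and> G i j \<and> p i \<le> p j + k \<and> p j \<le> p i + k}
      = {(i, j). i \<in> {..<n} \<and> j \<in> {..<n} \<and> i < j \<and> G i j \<and> p i \<le> p j + k \<and> p j \<le> p i + k}"
    by auto
  then show ?thesis
    using short_edges_le[OF G _ p, of k] sum_left_nbrs_le_short_edges[OF G, of k n] by simp
qed

section \<open>Robinson similarities\<close>

lemma symmetric_matrix_entry:
  "symmetric_matrix n A \<Longrightarrow> i < n \<Longrightarrow> j < n \<Longrightarrow> A $$ (i, j) = A $$ (j, i)"
  unfolding symmetric_matrix_def by (metis carrier_matD index_transpose_mat(1))

lemma robinson_similarity_inner_le: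
  assumes A: "robinson_similarity n A" and "i \<le> i'" "i' \<le> j'" "j' \<le> j" "j < n"
  shows "A $$ (i, j) \<le> A $$ (i', j')"
proof -
  have R: "A $$ (x, z) \<le> min (A $$ (x, y)) (A $$ (y, z))" if "x \<le> y" "y \<le> z" "z < n" for x y z
    using A that by (auto simp: robinson_similarity_def)
  have "A $$ (i, j) \<le> A $$ (i', j)" using R[of i i' j] assms by simp
  also have "\<dots> \<le> A $$ (i', j')" using R[of i' j' j] assms by simp
  finally show ?thesis .
qed

lemma toeplitz_shift:
  assumes C: "toeplitz n C"
  shows "i + m < n \<Longrightarrow> j + m < n \<Longrightarrow> C $$ (i + m, j + m) = C $$ (i, j)"
proof (induction m)
  case (Suc m)
  then show ?case using C by (auto simp: toeplitz_def)
qed simp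

lemma toeplitz_first_row:
  "toeplitz n C \<Longrightarrow> i \<le> j \<Longrightarrow> j < n \<Longrightarrow> C $$ (i, j) = C $$ (0, j - i)"
  using toeplitz_shift[of n C 0 i "j - i"] by simp

text \<open>
  The first row of \<open>C\<close> is nonincreasing, so its superlevel set is an initial segment. Off the diagonal
  the distance is positive, and \<open>k = 0\<close> stands for the empty superlevel set.
\<close>

lemma toeplitz_superlevel_band:
  assumes C: "robinson_similarity n C" and T: "toeplitz n C"
  obtains k where "\<And>i j. i < j \<Longrightarrow> j < n \<Longrightarrow> t \<le> C $$ (i, j) \<longleftrightarrow> j \<le> i + k"
proof
  define k where "k = Max (insert 0 {d. d < n \<and> t \<le> C $$ (0, d)})"
  fix i j :: nat assume ij: "i < j" "j < n"
  have first: "C $$ (i, j) = C $$ (0, j - i)"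
    using toeplitz_first_row[OF T, of i j] ij by simp
  have le_k: "d \<le> k" if "d < n" "t \<le> C $$ (0, d)" for d
    unfolding k_def using that by (intro Max_ge) auto
  have "k \<in> insert 0 {d. d < n \<and> t \<le> C $$ (0, d)}"
    unfolding k_def by (intro Max_in) auto
  then have attained: "k < n \<and> t \<le> C $$ (0, k)" if "k \<noteq> 0"
    using that by simp
  show "t \<le> C $$ (i, j) \<longleftrightarrow> j \<le> i + k"
  proof
    assume "t \<le> C $$ (i, j)"
    then have "j - i \<le> k" using first ij by (intro le_k) auto
    then show "j \<le> i + k" by simp
  next
    assume "j \<le> i + k"
    then have "j - i \<le> k" "k \<noteq> 0" using ij by auto
    then show "t \<le> C $$ (i, j)"
      using attained robinson_similarity_inner_le[OF C, of 0 0 "j - i" k] first by simp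
  qed
qed

lemma sum_symmetric_square:
  fixes f :: "nat \<Rightarrow> nat \<Rightarrow> real"
  assumes "\<And>i j. i < n \<Longrightarrow> j < n \<Longrightarrow> f i j = f j i"
  shows "(\<Sum>i = 0..<n. \<Sum>j = 0..<n. f i j)
    = (\<Sum>i = 0..<n. f i i) + 2 * (\<Sum>(i, j) | i < j \<and> j < n. f i j)"
proof -
  define U where "U = {(i, j). i < j \<and> j < n}"
  define D where "D = (\<lambda>i. (i, i)) ` {0..<n}"
  have finU: "finite U"
    by (rule finite_subset[of _ "{0..<n} \<times> {0..<n}"]) (auto simp: U_def)
  have split: "{0..<n} \<times> {0..<n} = (D \<union> U) \<union> prod.swap ` U"
    by (auto simp: U_def D_def image_iff)
  have "(\<Sum>i = 0..<n. \<Sum>j = 0..<n. f i j) = (\<Sum>(i, j)\<in>{0..<n} \<times> {0..<n}. f i j)"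
    by (simp add: sum.cartesian_product)
  also have "\<dots> = (\<Sum>(i, j)\<in>D \<union> U. f i j) + (\<Sum>(i, j)\<in>prod.swap ` U. f i j)"
    unfolding split using finU by (intro sum.union_disjoint) (auto simp: U_def D_def)
  also have "(\<Sum>(i, j)\<in>D \<union> U. f i j) = (\<Sum>(i, j)\<in>D. f i j) + (\<Sum>(i, j)\<in>U. f i j)"
    using finU by (intro sum.union_disjoint) (auto simp: U_def D_def)
  also have "(\<Sum>(i, j)\<in>D. f i j) = (\<Sum>i = 0..<n. f i i)"
    unfolding D_def by (subst sum.reindex) (auto simp: inj_on_def)
  also have "(\<Sum>(i, j)\<in>prod.swap ` U. f i j) = (\<Sum>(i, j)\<in>U. f j i)"
    by (subst sum.reindex) (auto simp: case_prod_unfold)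
  also have "\<dots> = (\<Sum>(i, j)\<in>U. f i j)"
    using assms by (intro sum.cong) (auto simp: U_def)
  finally show ?thesis by (simp add: U_def)
qed

lemma sum_square_permute:
  fixes f :: "nat \<Rightarrow> nat \<Rightarrow> real"
  assumes "p permutes {0..<n}"
  shows "(\<Sum>i = 0..<n. \<Sum>j = 0..<n. f (p i) (p j)) = (\<Sum>i = 0..<n. \<Sum>j = 0..<n. f i j)"
proof -
  have "(\<Sum>i = 0..<n. \<Sum>j = 0..<n. f (p i) (p j)) = (\<Sum>i = 0..<n. \<Sum>j = 0..<n. f (p i) j)"
    using sum.permute[OF assms, of "f (p i)" for i] by (simp add: o_def)
  also have "\<dots> = (\<Sum>i = 0..<n. \<Sum>j = 0..<n. f i j)"
    using sum.permute[OF assms, of "\<lambda>i. \<Sum>j = 0..<n. f i j"] by (simp add: o_def)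
  finally show ?thesis .
qed

text \<open>
  For thresholds \<open>s\<close> and \<open>t\<close>, the superlevel set of \<open>A\<close> is an interval-closed graph and that of
  the permuted \<open>C\<close> consists of the pairs that are close under \<open>p\<close>, so the counts are compared by
  the edge count for the layout \<open>p\<close>.
\<close>

lemma identity_maximises_toeplitz_pairing:
  assumes A: "robinson_similarity n A" and C: "robinson_similarity n C" and T: "toeplitz n C"
    and p: "p permutes {0..<n}"
  shows "(\<Sum>i = 0..<n. \<Sum>j = 0..<n. A $$ (i, j) * C $$ (p i, p j))
    \<le> (\<Sum>i = 0..<n. \<Sum>j = 0..<n. A $$ (i, j) * C $$ (i, j))"
proof -
  define U where "U = {(i, j). i < j \<and> j < n}"
  define a where "a = (\<lambda>(i, j). A $$ (i, j))"
  define c where "c = (\<lambda>(i, j). C $$ (i, j))"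
  define c' where "c' = (\<lambda>(i, j). C $$ (p i, p j))"
  have finU: "finite U"
    by (rule finite_subset[of _ "{0..<n} \<times> {0..<n}"]) (auto simp: U_def)
  have pn: "p i < n \<longleftrightarrow> i < n" for i
    using permutes_in_image[OF p, of i] by simp
  have p_inj: "inj p" using p by (rule permutes_inj)
  have symA: "A $$ (i, j) = A $$ (j, i)" if "i < n" "j < n" for i j
    using A that symmetric_matrix_entry by (auto simp: robinson_similarity_def)
  have symC: "C $$ (i, j) = C $$ (j, i)" if "i < n" "j < n" for i j
    using C that symmetric_matrix_entry by (auto simp: robinson_similarity_def)
  define d where "d = C $$ (0, 0)"
  have diagC: "C $$ (i, i) = d" if "i < n" for i
    using toeplitz_first_row[OF T, of i i] that by (simp add: d_def)
  \<comment> \<open>A permutation preserves the sum of all entries of \<open>C\<close>. It also preserves the sum of the diagonal,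
     which is constant, and therefore the sum over \<open>U\<close>.\<close>
  have total: "(\<Sum>x\<in>U. c' x) = (\<Sum>x\<in>U. c x)"
  proof -
    have "(\<Sum>i = 0..<n. C $$ (p i, p i)) + 2 * (\<Sum>(i, j) | i < j \<and> j < n. C $$ (p i, p j))
        = (\<Sum>i = 0..<n. \<Sum>j = 0..<n. C $$ (p i, p j))"
      by (rule sum_symmetric_square[symmetric]) (use symC pn in simp)
    also have "\<dots> = (\<Sum>i = 0..<n. \<Sum>j = 0..<n. C $$ (i, j))"
      by (rule sum_square_permute[OF p])
    also have "\<dots> = (\<Sum>i = 0..<n. C $$ (i, i)) + 2 * (\<Sum>(i, j) | i < j \<and> j < n. C $$ (i, j))"
      by (rule sum_symmetric_square) (use symC in simp)
    finally show ?thesis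
      using diagC pn by (simp add: U_def c_def c'_def)
  qed
  have counts: "card {x \<in> U. s \<le> a x \<and> t \<le> c' x} \<le> card {x \<in> U. s \<le> a x \<and> t \<le> c x}" for s t
  proof -
    obtain k where k: "\<And>i j. i < j \<Longrightarrow> j < n \<Longrightarrow> t \<le> C $$ (i, j) \<longleftrightarrow> j \<le> i + k"
      using toeplitz_superlevel_band[OF C T] by blast
    define G where "G i j \<longleftrightarrow> j < n \<and> s \<le> A $$ (i, j)" for i j
    have G: "interval_closed G"
      unfolding interval_closed_def G_def
    proof (intro allI impI)
      fix i i' j' j
      assume "i \<le> i' \<and> i' < j' \<and> j' \<le> j \<and> j < n \<and> s \<le> A $$ (i, j)"
      then show "j' < n \<and> s \<le> A $$ (i', j')"
        using robinson_similarity_inner_le[OF A, of i i' j' j] by linarith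
    qed
    have near: "t \<le> C $$ (p i, p j) \<longleftrightarrow> p i \<le> p j + k \<and> p j \<le> p i + k" if "i < j" "j < n" for i j
    proof (cases "p i < p j")
      case True
      then show ?thesis using k[of "p i" "p j"] pn that by auto
    next
      case False
      then have "p j < p i" using that inj_eq[OF p_inj, of i j] by simp
      then show ?thesis using k[of "p j" "p i"] pn[of i] pn[of j] symC[of "p i" "p j"] that by auto
    qed
    have "{x \<in> U. s \<le> a x \<and> t \<le> c' x}
        = {(i, j). i < j \<and> j < n \<and> G i j \<and> p i \<le> p j + k \<and> p j \<le> p i + k}"
      using near by (auto simp: U_def a_def c'_def G_def)
    moreover have "{x \<in> U. s \<le> a x \<and> t \<le> c x} = {(i, j). i < j \<and> j < n \<and> G i j \<and> j \<le> i + k}"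
      using k by (auto simp: U_def a_def c_def G_def)
    ultimately show ?thesis
      using identity_maximises_short_edges[OF G, of p n k] p_inj
      by (simp add: inj_on_subset)
  qed
  have off_diag: "(\<Sum>(i, j) | i < j \<and> j < n. A $$ (i, j) * C $$ (p i, p j))
      \<le> (\<Sum>(i, j) | i < j \<and> j < n. A $$ (i, j) * C $$ (i, j))"
    using sum_mult_le_of_superlevel_counts[OF finU total counts]
    by (simp add: U_def a_def c_def c'_def case_prod_unfold)
  have "(\<Sum>i = 0..<n. \<Sum>j = 0..<n. A $$ (i, j) * C $$ (p i, p j))
      = (\<Sum>i = 0..<n. A $$ (i, i) * C $$ (p i, p i))
        + 2 * (\<Sum>(i, j) | i < j \<and> j < n. A $$ (i, j) * C $$ (p i, p j))"
    by (rule sum_symmetric_square) (use symA symC pn in simp)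
  also have "(\<Sum>i = 0..<n. A $$ (i, i) * C $$ (p i, p i)) = (\<Sum>i = 0..<n. A $$ (i, i) * C $$ (i, i))"
    using diagC pn by simp
  also have "\<dots> + 2 * (\<Sum>(i, j) | i < j \<and> j < n. A $$ (i, j) * C $$ (p i, p j))
      \<le> \<dots> + 2 * (\<Sum>(i, j) | i < j \<and> j < n. A $$ (i, j) * C $$ (i, j))"
    using off_diag by simp
  also have "\<dots> = (\<Sum>i = 0..<n. \<Sum>j = 0..<n. A $$ (i, j) * C $$ (i, j))"
    by (rule sum_symmetric_square[symmetric]) (use symA symC in simp)
  finally show ?thesis .
qed

theorem theorem4:
  fixes n :: nat and A B :: "real mat"
  assumes "symmetric_matrix n A" and "symmetric_matrix n B"
    and "robinson_similarity n A"
    and "robinson_dissimilarity n B"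
    and "toeplitz n A \<or> toeplitz n B"
  shows "qap_optimal n A B id \<and>
    (\<forall>\<pi>. \<pi> permutes {0..<n} \<longrightarrow>
      (\<Sum>i = 0..<n. \<Sum>j = 0..<n. A $$ (i, j) * B $$ (\<pi> i, \<pi> j))
        \<ge> (\<Sum>i = 0..<n. \<Sum>j = 0..<n. A $$ (i, j) * B $$ (i, j)))"
proof -
  define C where "C = - B"
  have C: "robinson_similarity n C"
    using assms(4) by (simp add: robinson_dissimilarity_def C_def)
  have dimB: "B \<in> carrier_mat n n" using assms(2) by (simp add: symmetric_matrix_def)
  have entry: "C $$ (i, j) = - B $$ (i, j)" if "i < n" "j < n" for i j
    using that dimB by (simp add: C_def)
  have main: "(\<Sum>i = 0..<n. \<Sum>j = 0..<n. A $$ (i, j) * B $$ (i, j))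
      \<le> (\<Sum>i = 0..<n. \<Sum>j = 0..<n. A $$ (i, j) * B $$ (p i, p j))"
    if p: "p permutes {0..<n}" for p
  proof -
    have pn: "p i < n \<longleftrightarrow> i < n" for i
      using permutes_in_image[OF p, of i] by simp
    have "(\<Sum>i = 0..<n. \<Sum>j = 0..<n. A $$ (i, j) * C $$ (p i, p j))
        \<le> (\<Sum>i = 0..<n. \<Sum>j = 0..<n. A $$ (i, j) * C $$ (i, j))"
      using assms(5)
    proof
      assume T: "toeplitz n A"
      \<comment> \<open>Reindexing by \<open>p\<close> moves the permutation from \<open>C\<close> to the Toeplitz matrix \<open>A\<close>.\<close>
      define q where "q = inv_into UNIV p"
      have q: "q permutes {0..<n}" using p permutes_inv q_def by blast
      have qp: "q (p i) = i" for i using p permutes_inverses(2) q_def by metis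
      have "(\<Sum>i = 0..<n. \<Sum>j = 0..<n. A $$ (i, j) * C $$ (p i, p j))
          = (\<Sum>i = 0..<n. \<Sum>j = 0..<n. C $$ (i, j) * A $$ (q i, q j))"
        using sum_square_permute[OF p, of "\<lambda>i j. C $$ (i, j) * A $$ (q i, q j)"]
        by (simp add: qp mult.commute)
      also have "\<dots> \<le> (\<Sum>i = 0..<n. \<Sum>j = 0..<n. C $$ (i, j) * A $$ (i, j))"
        by (rule identity_maximises_toeplitz_pairing[OF C assms(3) T q])
      finally show ?thesis by (simp add: mult.commute)
    next
      assume "toeplitz n B"
      then have T: "toeplitz n C"
        using entry dimB by (auto simp: toeplitz_def C_def)
      show ?thesis
        by (rule identity_maximises_toeplitz_pairing[OF assms(3) C T p])
    qed
    then show ?thesis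
      using entry pn by (simp add: sum_negf)
  qed
  moreover have "qap_optimal n A B id"
    unfolding qap_optimal_def is_arg_min_def qap_cost_def
    using main permutes_id by (fastforce simp: not_less)
  ultimately show ?thesis by blast
qed

end
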